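(* $R_3(\mathcal{B}(K_4),2)=6$.
   Context: For a graph $G$, a hypergraph $H$ is a Berge-$G$ hypergraph if there are an injective map $\phi:V(G)\to V(H)$ and pairwise distinct hyperedges $e_{xy}\in E(H)$, one for each $xy\in E(G)$, with $\phi(x),\phi(y)\in e_{xy}$. $\mathcal{B}(G)$ denotes the family of all Berge-$G$ hypergraphs. For a family $\mathcal{H}$ of $3$-uniform hypergraphs, $R_3(\mathcal{H},k)$ is the smallest $n$ such that every $k$-coloring of the hyperedges of the complete $3$-uniform hypergraph $K_n^3$ contains a monochromatic subhypergraph belonging to $\mathcal{H}$. *)

theory Defs
  imports Main
begin

text \<open>A graph is given by a vertex set and a set of edges (2-element subsets).
A hypergraph is a pair (vertex set, set of hyperedges).\<close>

type_synonym ('a) hypergraph = "'a set \<times> 'a set set"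

definition is_berge :: "'a set \<Rightarrow> 'a set set \<Rightarrow> 'b hypergraph \<Rightarrow> bool" where
  "is_berge VG EG H \<longleftrightarrow>
     (\<exists>\<phi> e. inj_on \<phi> VG \<and> \<phi> ` VG \<subseteq> fst H \<and> inj_on e EG \<and>
        (\<forall>xy\<in>EG. e xy \<in> snd H \<and> \<phi> ` xy \<subseteq> e xy))"

definition Berge :: "'a set \<Rightarrow> 'a set set \<Rightarrow> 'b hypergraph set" where
  "Berge VG EG = {H. is_berge VG EG H}"

definition K_vert :: "nat \<Rightarrow> nat set" where "K_vert m = {0..<m}"
definition K_edges :: "nat \<Rightarrow> nat set set" where
  "K_edges m = {e. e \<subseteq> {0..<m} \<and> card e = 2}"

definition K3_edges :: "nat \<Rightarrow> nat set set" where
  "K3_edges n = {e. e \<subseteq> {0..<n} \<and> card e = 3}"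

definition arrows3 :: "nat \<Rightarrow> nat hypergraph set \<Rightarrow> nat \<Rightarrow> bool" where
  "arrows3 n F k \<longleftrightarrow>
     (\<forall>c :: nat set \<Rightarrow> nat. (\<forall>e\<in>K3_edges n. c e < k) \<longrightarrow>
        (\<exists>i<k. \<exists>V E. V \<subseteq> {0..<n} \<and> E \<subseteq> {e\<in>K3_edges n. c e = i} \<and>
                     (\<forall>e\<in>E. e \<subseteq> V) \<and> (V, E) \<in> F))"

definition R3 :: "nat hypergraph set \<Rightarrow> nat \<Rightarrow> nat" where
  "R3 F k = (LEAST n. arrows3 n F k)"

end

theory Submission
  imports Defs "HOL-Combinatorics.Transposition"
begin

text \<open>The lower bound is a count: \<open>K\<^sub>5\<^sup>3\<close> has ten edges, five can be given to each colour, and a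
Berge-\<open>K\<^sub>4\<close> needs six. For the upper bound one colour class of \<open>K\<^sub>6\<^sup>3\<close> has at least ten edges, and any
ten triples on six points contain a Berge-\<open>K\<^sub>4\<close>. Indeed any six triples on five points do (finite
check), so we are done if some vertex is missed by six edges. Otherwise double counting shows that
there are exactly ten edges and every vertex is missed by exactly five. For each of the 252 choices \<open>F\<close> of
the five edges missing a given vertex, fewer than five triples \<open>p\<close> through that vertex fail to
complete \<open>F\<close> to a Berge-\<open>K\<^sub>4\<close>, or exactly five fail, and then adding all of them to \<open>F\<close> leaves some
other vertex missed by six edges.\<close>

section \<open>Berge copies of \<open>K\<^sub>4\<close>\<close>

lemma K_edges_4: "K_edges 4 = {{0,1},{0,2},{0,3},{1,2},{1,3},{2,3}}" (is "_ = ?R")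
proof
  show "K_edges 4 \<subseteq> ?R"
  proof
    fix s assume "s \<in> K_edges 4"
    then obtain x y where s: "s = {x, y}" "x \<noteq> y" and "x < 4" "y < 4"
      by (auto simp: K_edges_def card_2_iff)
    then have "x \<in> {0,1,2,3}" "y \<in> {0,1,2,3}" by auto
    with s show "s \<in> ?R" by (elim insertE emptyE; simp add: doubleton_eq_iff)
  qed
qed (auto simp: K_edges_def)

lemma is_berge_K4I:
  assumes "distinct [a, b, c, d]" "{a, b, c, d} \<subseteq> V"
    and e: "distinct [e1, e2, e3, e4, e5, e6]" "{e1, e2, e3, e4, e5, e6} \<subseteq> E"
    and "{a, b} \<subseteq> e1" "{a, c} \<subseteq> e2" "{a, d} \<subseteq> e3" "{b, c} \<subseteq> e4" "{b, d} \<subseteq> e5" "{c, d} \<subseteq> e6"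
  shows "is_berge (K_vert 4) (K_edges 4) (V, E)"
proof -
  define \<phi> where "\<phi> = (!) [a, b, c, d]"
  \<comment> \<open>The last branch gives the value at \<open>{2, 3}\<close> and doubles as the
    default outside \<open>K_edges 4\<close>.\<close>
  define f where "f = (\<lambda>s. if s = {0::nat,1} then e1 else if s = {0,2} then e2 else if s = {0,3} then e3
    else if s = {1,2} then e4 else if s = {1,3} then e5 else e6 :: 'a set)"
  have V4: "K_vert 4 = {0, 1, 2, 3}" by (auto simp: K_vert_def)
  have \<phi>: "\<phi> 0 = a" "\<phi> 1 = b" "\<phi> (Suc 0) = b" "\<phi> 2 = c" "\<phi> 3 = d"
    by (simp_all add: \<phi>_def numeral_2_eq_2 numeral_3_eq_3)
  have f: "f {0,1} = e1" "f {0,2} = e2" "f {0,3} = e3" "f {1,2} = e4" "f {1,3} = e5" "f {2,3} = e6"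
    by (simp_all add: f_def doubleton_eq_iff)
  have "inj_on \<phi> (K_vert 4)" "\<phi> ` K_vert 4 \<subseteq> V"
    using assms(1,2) by (auto simp: V4 \<phi> inj_on_def)
  moreover have "distinct (map f [{0,1},{0,2},{0,3},{1,2},{1,3},{2,3}])"
    using e(1) by (simp only: list.map f)
  then have "inj_on f (K_edges 4)"
    by (simp only: distinct_map K_edges_4 list.set)
  moreover have "\<forall>s\<in>K_edges 4. f s \<in> E \<and> \<phi> ` s \<subseteq> f s"
    unfolding K_edges_4 using assms(4-) by (simp add: f \<phi> del: One_nat_def)
  ultimately show ?thesis
    unfolding is_berge_def fst_conv snd_conv by (intro exI[of _ \<phi>] exI[of _ f] conjI)
qed

lemma is_berge_mono:
  assumes "is_berge VG EG (V, E)" "E \<subseteq> E'"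
  shows "is_berge VG EG (V, E')"
proof -
  obtain \<phi> e where *: "inj_on \<phi> VG" "\<phi> ` VG \<subseteq> V" "inj_on e EG" "\<forall>s\<in>EG. e s \<in> E \<and> \<phi> ` s \<subseteq> e s"
    using assms(1) unfolding is_berge_def by auto
  with assms(2) have "\<forall>s\<in>EG. e s \<in> E' \<and> \<phi> ` s \<subseteq> e s" by blast
  with * show ?thesis
    unfolding is_berge_def fst_conv snd_conv by (intro exI[of _ \<phi>] exI[of _ e] conjI)
qed

text \<open>Provides the symmetry argument: relabelling the points transports a Berge copy.
  Injectivity of \<open>f\<close> on the whole type makes the image map injective on sets, so the
  chosen hyperedges stay distinct.\<close>

lemma is_berge_image:
  assumes "is_berge VG EG (V, E)" and f: "inj f" "f ` V \<subseteq> V'"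
  shows "is_berge VG EG (V', (`) f ` E)"
proof -
  obtain \<phi> e where *: "inj_on \<phi> VG" "\<phi> ` VG \<subseteq> V" "inj_on e EG" "\<forall>s\<in>EG. e s \<in> E \<and> \<phi> ` s \<subseteq> e s"
    using assms(1) unfolding is_berge_def by auto
  have "inj_on (f \<circ> \<phi>) VG" using * f by (simp add: comp_inj_on inj_on_subset)
  moreover have "inj_on (\<lambda>s. f ` e s) EG"
    using * f by (auto simp: inj_on_def inj_image_eq_iff)
  moreover have "(f \<circ> \<phi>) ` VG \<subseteq> V'" using * f by fastforce
  moreover have "\<forall>s\<in>EG. f ` e s \<in> (`) f ` E \<and> (f \<circ> \<phi>) ` s \<subseteq> f ` e s"
    using * by fastforce
  ultimately show ?thesis unfolding is_berge_def fst_conv snd_conv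
    by (intro exI[of _ "f \<circ> \<phi>"] exI[of _ "\<lambda>s. f ` e s"] conjI)
qed

lemma card_le_if_is_berge:
  assumes "is_berge VG EG (V, E)" "finite E"
  shows "card EG \<le> card E"
  using assms unfolding is_berge_def by (auto intro!: card_inj_on_le)

lemma card_K3_edges: "card (K3_edges n) = n choose 3"
  using n_subsets[of "{0..<n}" 3] by (simp add: K3_edges_def)

lemma finite_K3_edges: "finite (K3_edges n)"
  by (simp add: K3_edges_def)

section \<open>The finite checks\<close>

text \<open>Compares positions in listing order only. For the increasing pairs and triples listed
  below this amounts to containment; soundness uses just the forward direction,
  \<open>pair_in_tset\<close>.\<close>

fun pair_in :: "'a \<times> 'a \<Rightarrow> 'a \<times> 'a \<times> 'a \<Rightarrow> bool" where
  "pair_in (a, b) (x, y, z) =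
     (if a = x then (if b = y then True else b = z) else if a = y then b = z else False)"

fun tset :: "'a \<times> 'a \<times> 'a \<Rightarrow> 'a set" where
  "tset (x, y, z) = {x, y, z}"

text \<open>Search for distinct triples covering the given pairs; \<open>S\<close> holds the triples already rejected
for the first pair. Conditionals replace the connectives because \<open>code_simp\<close> evaluates both
arguments of a connective, but not the unused branch of a conditional.\<close>

fun covers :: "('a \<times> 'a) list \<Rightarrow> ('a \<times> 'a \<times> 'a) list \<Rightarrow> ('a \<times> 'a \<times> 'a) list \<Rightarrow> bool" where
  "covers [] S L = True"
| "covers (p # ps) S [] = False"
| "covers (p # ps) S (t # L) =
     (if pair_in p t then (if covers ps [] (S @ L) then True else covers (p # ps) (t # S) L)
      else covers (p # ps) (t # S) L)"

lemma pair_in_tset: "pair_in (a, b) t \<Longrightarrow> {a, b} \<subseteq> tset t"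
  by (cases t) (auto split: if_splits)

text \<open>\<open>S @ L\<close> is the pool of triples still available. Choosing \<open>t\<close>
  removes it from the pool, and the triples rejected for this pair return for the next ones; as the
  pool is distinct, no triple is chosen twice.\<close>

lemma covers_sound:
  assumes "covers ps S L" "distinct (S @ L)"
  shows "\<exists>ts. distinct ts \<and> set ts \<subseteq> set (S @ L) \<and> list_all2 pair_in ps ts"
  using assms
proof (induction ps S L rule: covers.induct)
  case (3 p ps S t L)
  show ?case
  proof (cases "pair_in p t \<and> covers ps [] (S @ L)")
    case True
    then obtain ts where "distinct ts" "set ts \<subseteq> set (S @ L)" "list_all2 pair_in ps ts"
      using 3 by auto
    with True "3.prems" show ?thesis by (intro exI[of _ "t # ts"]) auto
  next
    case False
    then have "covers (p # ps) (t # S) L" using "3.prems" by (auto split: if_splits)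
    moreover have "distinct ((t # S) @ L)" using "3.prems" by auto
    ultimately have "\<exists>ts. distinct ts \<and> set ts \<subseteq> set ((t # S) @ L) \<and> list_all2 pair_in (p # ps) ts"
      using "3.IH"(2,3) False by blast
    then show ?thesis by simp
  qed
qed auto

fun K4_pairs :: "'a \<times> 'a \<times> 'a \<times> 'a \<Rightarrow> ('a \<times> 'a) list" where
  "K4_pairs (a, b, c, d) = [(a,b),(a,c),(a,d),(b,c),(b,d),(c,d)]"

fun K4_covered :: "('a \<times> 'a \<times> 'a \<times> 'a) list \<Rightarrow> ('a \<times> 'a \<times> 'a) list \<Rightarrow> bool" where
  "K4_covered [] L = False"
| "K4_covered (q # qs) L = (if covers (K4_pairs q) [] L then True else K4_covered qs L)"

text \<open>The four core vertices are sought among 0 to 4 only, although the hyperedges may contain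
  5. This suffices for both finite checks.\<close>

definition quads :: "(nat \<times> nat \<times> nat \<times> nat) list" where
  "quads = [(0,1,2,3),(0,1,2,4),(0,1,3,4),(0,2,3,4),(1,2,3,4)]"

definition triples :: "(nat \<times> nat \<times> nat) list" where
  "triples = [(0,1,2),(0,1,3),(0,1,4),(0,2,3),(0,2,4),(0,3,4),(1,2,3),(1,2,4),(1,3,4),(2,3,4)]"

definition link :: "(nat \<times> nat \<times> nat) list" where
  "link = [(0,1,5),(0,2,5),(0,3,5),(0,4,5),(1,2,5),(1,3,5),(1,4,5),(2,3,5),(2,4,5),(3,4,5)]"

lemma K4_covered_iff: "K4_covered qs L \<longleftrightarrow> (\<exists>q\<in>set qs. covers (K4_pairs q) [] L)"
  by (induction qs) auto

lemma is_berge_if_covered: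
  assumes "K4_covered quads L" "distinct L" "inj_on tset (set L)"
  shows "is_berge (K_vert 4) (K_edges 4) ({0..<6}, tset ` set L)"
proof -
  obtain q where q: "q \<in> set quads" "covers (K4_pairs q) [] L"
    using assms(1) by (auto simp: K4_covered_iff)
  obtain a b c d where abcd: "q = (a, b, c, d)" by (cases q)
  with q(1) have "distinct [a, b, c, d]" "{a, b, c, d} \<subseteq> {0..<6}" by (auto simp: quads_def)
  moreover obtain ts where ts: "distinct ts" "set ts \<subseteq> set L" "list_all2 pair_in (K4_pairs q) ts"
    using covers_sound[OF q(2)] assms(2) by auto
  then obtain t1 t2 t3 t4 t5 t6 where l: "ts = [t1, t2, t3, t4, t5, t6]"
    by (auto simp: abcd list_all2_Cons1)
  have "distinct (map tset ts)"
    using ts assms(3) by (auto simp: distinct_map intro: inj_on_subset)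
  then have "distinct [tset t1, tset t2, tset t3, tset t4, tset t5, tset t6]"
    by (simp only: l list.map)
  moreover have "{tset t1, tset t2, tset t3, tset t4, tset t5, tset t6} \<subseteq> tset ` set L"
    using ts(2) by (auto simp: l)
  moreover have "pair_in (a,b) t1" "pair_in (a,c) t2" "pair_in (a,d) t3"
    "pair_in (b,c) t4" "pair_in (b,d) t5" "pair_in (c,d) t6"
    using ts(3) by (simp_all add: l abcd)
  note this[THEN pair_in_tset]
  ultimately show ?thesis by (rule is_berge_K4I)
qed

section \<open>Subsets of a given size as lists\<close>

fun sublists :: "nat \<Rightarrow> 'a list \<Rightarrow> 'a list list" where
  "sublists 0 xs = [[]]"
| "sublists (Suc n) [] = []"
| "sublists (Suc n) (x # xs) = map ((#) x) (sublists n xs) @ sublists (Suc n) xs"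

lemma ex_sublists:
  assumes "M \<subseteq> set xs" "distinct xs" "card M = n"
  shows "\<exists>L\<in>set (sublists n xs). distinct L \<and> set L = M"
  using assms
proof (induction n xs arbitrary: M rule: sublists.induct)
  case (1 xs)
  then have "M = {}" using finite_subset by fastforce
  then show ?case by simp
next
  case (3 n x xs)
  have fin: "finite M" using "3.prems"(1) by (rule finite_subset) simp
  show ?case
  proof (cases "x \<in> M")
    case True
    have "distinct xs" "M - {x} \<subseteq> set xs" "card (M - {x}) = n" using "3.prems" True fin by auto
    then obtain L where "L \<in> set (sublists n xs)" "distinct L" "set L = M - {x}"
      using "3.IH"(1) by blast
    with True show ?thesis by (intro bexI[of _ "x # L"]) auto
  next
    case False
    then have "distinct xs" "M \<subseteq> set xs" using "3.prems" by auto
    then obtain L where "L \<in> set (sublists (Suc n) xs)" "distinct L" "set L = M"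
      using "3.IH"(2) "3.prems"(3) by blast
    then show ?thesis by (intro bexI[of _ L]) auto
  qed
qed auto

text \<open>Links the evaluated checks, which range over lists of encoded triples, to arbitrary sets
  \<open>M\<close> of hyperedges.\<close>

lemma ex_sublists_image:
  assumes "M \<subseteq> f ` set xs" "distinct xs" "inj_on f (set xs)"
  shows "\<exists>L\<in>set (sublists (card M) xs). distinct L \<and> set L \<subseteq> set xs \<and> f ` set L = M"
proof -
  define N where "N = {x \<in> set xs. f x \<in> M}"
  have N: "f ` N = M" "N \<subseteq> set xs" using assms(1) unfolding N_def by blast+
  then have "card M = card N" using assms(3) inj_on_subset card_image by metis
  moreover obtain L where "L \<in> set (sublists (card N) xs)" "distinct L" "set L = N"
    using ex_sublists[OF N(2) assms(2) refl] by blast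
  ultimately show ?thesis using N by (intro bexI[of _ L]) simp_all
qed

lemma six_triples: "list_all (K4_covered quads) (sublists 6 triples)"
  by code_simp

fun misses :: "'a \<Rightarrow> 'a \<times> 'a \<times> 'a \<Rightarrow> bool" where
  "misses w (x, y, z) \<longleftrightarrow> w \<noteq> x \<and> w \<noteq> y \<and> w \<noteq> z"

text \<open>Vertex 5 is left out of the range of \<open>w\<close>: in the intended use
  \<open>L\<close> consists of five triples through 5 and five avoiding it, so 5 is missed by only
  five.\<close>

definition missed_by_six :: "(nat \<times> nat \<times> nat) list \<Rightarrow> bool" where
  "missed_by_six L = list_ex (\<lambda>w. 6 \<le> length (filter (misses w) L)) [0,1,2,3,4]"

text \<open>Here \<open>B\<close> stands for the triples through 5 that do not complete
  \<open>F\<close>. The five edges through 5 of a counterexample would all lie in \<open>B\<close>: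
  impossible if \<open>B\<close> is shorter than five, while length five forces them to be exactly
  \<open>B\<close>.\<close>

definition few :: "(nat \<times> nat \<times> nat) list \<Rightarrow> (nat \<times> nat \<times> nat) list \<Rightarrow> bool" where
  "few B F = (if length B < 5 then True else if length B = 5 then missed_by_six (B @ F) else False)"

definition bad :: "(nat \<times> nat \<times> nat) list \<Rightarrow> (nat \<times> nat \<times> nat) list" where
  "bad F = filter (\<lambda>p. \<not> K4_covered quads (p # F)) link"

definition few_bad :: "(nat \<times> nat \<times> nat) list \<Rightarrow> bool" where
  "few_bad F = few (bad F) F"

lemma five_triples: "list_all few_bad (sublists 5 triples)"
  by code_simp

section \<open>Ten triples on six points\<close>

text \<open>The two lists encode 20 distinct sets, and \<open>K3_edges 6\<close> has 20 elements, so
  the easy inclusions are equalities.\<close>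

lemma tset_triples: "tset ` set triples = {e \<in> K3_edges 6. 5 \<notin> e}"
  and tset_link: "tset ` set link = {e \<in> K3_edges 6. 5 \<in> e}"
  and inj_on_tset: "inj_on tset (set (triples @ link))"
  and distinct_triples: "distinct (triples @ link)"
proof -
  show dist: "distinct (triples @ link)" by (simp add: triples_def link_def)
  show inj: "inj_on tset (set (triples @ link))"
  proof (rule inj_onI)
    fix s t assume *: "s \<in> set (triples @ link)" "t \<in> set (triples @ link)" "tset s = tset t"
    have sorted: "\<forall>(x, y, z)\<in>set (triples @ link). x < y \<and> y < z"
      by (simp add: triples_def link_def)
    obtain x y z x' y' z' where st: "s = (x, y, z)" "t = (x', y', z')" by (cases s, cases t)
    with sorted * have lt: "x < y" "y < z" "x' < y'" "y' < z'" by blast+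
    have eq: "{x, y, z} = {x', y', z'}" using *(3) st by simp
    \<comment> \<open>An increasing triple is recovered from its set: the minimum and maximum give
      the outer entries, and the sum then gives the middle one.\<close>
    have "x = x'" using arg_cong[OF eq, of Min] lt by simp
    moreover have "z = z'" using arg_cong[OF eq, of Max] lt by simp
    moreover have "x + (y + z) = x' + (y' + z')" using arg_cong[OF eq, of "sum id"] lt by simp
    ultimately show "s = t" using st by simp
  qed
  have "card (tset ` set (triples @ link)) = 20"
    using dist inj by (simp add: card_image distinct_card del: set_append)
      (simp add: triples_def link_def)
  moreover have sub: "tset ` set triples \<subseteq> {e \<in> K3_edges 6. 5 \<notin> e}"
    "tset ` set link \<subseteq> {e \<in> K3_edges 6. 5 \<in> e}"
    by (auto simp: triples_def link_def K3_edges_def)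
  moreover have "card (K3_edges 6) = 20"
    by (simp add: card_K3_edges numeral_eq_Suc)
  ultimately have "tset ` set (triples @ link) = K3_edges 6"
    by (intro card_subset_eq finite_K3_edges) auto
  then have un: "e \<in> tset ` set triples \<or> e \<in> tset ` set link" if "e \<in> K3_edges 6" for e
    using that unfolding set_append image_Un by blast
  show "tset ` set triples = {e \<in> K3_edges 6. 5 \<notin> e}"
  proof (intro equalityI sub(1) subsetI)
    fix e :: "nat set" assume e: "e \<in> {e \<in> K3_edges 6. 5 \<notin> e}"
    with sub(2) have "e \<notin> tset ` set link" by blast
    with e un[of e] show "e \<in> tset ` set triples" by simp
  qed
  show "tset ` set link = {e \<in> K3_edges 6. 5 \<in> e}"
  proof (intro equalityI sub(2) subsetI)
    fix e :: "nat set" assume e: "e \<in> {e \<in> K3_edges 6. 5 \<in> e}"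
    with sub(1) have "e \<notin> tset ` set triples" by blast
    with e un[of e] show "e \<in> tset ` set link" by simp
  qed
qed

text \<open>Edges avoiding 5 live on the five points 0 to 4, where \<open>six_triples\<close>
  applies.\<close>

lemma is_berge_if_six_avoid_5:
  assumes E: "E \<subseteq> K3_edges 6" and "6 \<le> card {e \<in> E. 5 \<notin> e}"
  shows "is_berge (K_vert 4) (K_edges 4) ({0..<6}, E)"
proof -
  obtain M where M: "M \<subseteq> {e \<in> E. 5 \<notin> e}" "card M = 6"
    using assms(2) by (meson obtain_subset_with_card_n)
  then have "M \<subseteq> tset ` set triples" using E by (auto simp: tset_triples)
  moreover have "inj_on tset (set triples)" "distinct triples"
    using inj_on_tset distinct_triples by (auto intro: inj_on_subset)
  ultimately obtain L where L: "L \<in> set (sublists 6 triples)" "distinct L" "set L \<subseteq> set triples"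
      "tset ` set L = M"
    using ex_sublists_image[of M tset triples] M(2) by auto
  have "K4_covered quads L" using six_triples L(1) by (auto simp: list_all_iff)
  then have "is_berge (K_vert 4) (K_edges 4) ({0..<6}, tset ` set L)"
    using L inj_on_tset by (intro is_berge_if_covered) (auto intro: inj_on_subset)
  then show ?thesis by (rule is_berge_mono) (use L(4) M(1) in auto)
qed

text \<open>Swapping \<open>v\<close> with 5 reduces to the previous lemma; the swap is an
  involution, so applying it again carries the Berge copy back to \<open>E\<close>.\<close>

lemma is_berge_if_six_avoid:
  assumes E: "E \<subseteq> K3_edges 6" and "v < 6" and "6 \<le> card {e \<in> E. v \<notin> e}"
  shows "is_berge (K_vert 4) (K_edges 4) ({0..<6}, E)"
proof -
  define f where "f = transpose v (5::nat)"
  have f: "inj f" "\<And>x. f (f x) = x" by (auto simp: f_def)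
  have fv: "f x < 6 \<longleftrightarrow> x < 6" for x using \<open>v < 6\<close> by (auto simp: f_def transpose_def)
  have ff: "(`) f ` (`) f ` E = E" by (simp add: image_image f)
  have "card {e \<in> (`) f ` E. 5 \<notin> e} = card ((`) f ` {e \<in> E. v \<notin> e})"
  proof (rule arg_cong[where f = card])
    have "5 \<in> f ` e \<longleftrightarrow> v \<in> e" for e
      using inj_image_mem_iff[OF f(1), of v e] by (simp add: f_def)
    then show "{e \<in> (`) f ` E. 5 \<notin> e} = (`) f ` {e \<in> E. v \<notin> e}" by auto
  qed
  also have "\<dots> = card {e \<in> E. v \<notin> e}"
    using f(1) by (intro card_image) (auto simp: inj_on_def inj_image_eq_iff)
  finally have "6 \<le> card {e \<in> (`) f ` E. 5 \<notin> e}" using assms(3) by simp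
  moreover have "(`) f ` E \<subseteq> K3_edges 6"
  proof (rule image_subsetI)
    fix e assume "e \<in> E"
    then have "e \<subseteq> {0..<6}" "card e = 3" using E by (auto simp: K3_edges_def)
    moreover have "card (f ` e) = card e" by (rule card_image) (use f(1) inj_on_subset in blast)
    ultimately show "f ` e \<in> K3_edges 6" using fv by (auto simp: K3_edges_def)
  qed
  ultimately have "is_berge (K_vert 4) (K_edges 4) ({0..<6}, (`) f ` E)"
    by (intro is_berge_if_six_avoid_5)
  moreover have "f ` {0..<6} \<subseteq> {0..<6}" by (rule image_subsetI) (simp add: fv)
  ultimately have "is_berge (K_vert 4) (K_edges 4) ({0..<6}, (`) f ` (`) f ` E)"
    using is_berge_image[of "K_vert 4" "K_edges 4" "{0..<6}" "(`) f ` E" f "{0..<6}"] f(1) by simp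
  then show ?thesis by (simp only: ff)
qed

lemma misses_iff: "misses w t \<longleftrightarrow> w \<notin> tset t"
  by (cases t) auto

text \<open>In a counterexample no edge through 5 completes the five edges \<open>F\<close> avoiding
  5, so all of them lie in \<open>bad F\<close>. The check then leaves only the case where
  \<open>bad F @ F\<close> lists \<open>E\<close> itself and some vertex is missed by six edges,
  which the previous case excludes.\<close>

lemma is_berge_if_five_five:
  assumes E: "E \<subseteq> K3_edges 6" and "card {e \<in> E. 5 \<notin> e} = 5" "card {e \<in> E. 5 \<in> e} = 5"
  shows "is_berge (K_vert 4) (K_edges 4) ({0..<6}, E)"
proof (rule ccontr)
  assume not: "\<not> ?thesis"
  have inj: "inj_on tset (set triples \<union> set link)" using inj_on_tset by simp
  have dist: "distinct triples" "distinct link" "set triples \<inter> set link = {}"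
    using distinct_triples by simp_all
  have "{e \<in> E. 5 \<notin> e} \<subseteq> tset ` set triples" using E by (auto simp: tset_triples)
  moreover have "inj_on tset (set triples)" using inj by (auto intro: inj_on_subset)
  ultimately obtain F where F: "F \<in> set (sublists 5 triples)" "distinct F" "set F \<subseteq> set triples"
      "tset ` set F = {e \<in> E. 5 \<notin> e}"
    using ex_sublists_image[of "{e \<in> E. 5 \<notin> e}" tset triples] dist(1) unfolding assms(2) by blast
  define P where "P = {p \<in> set link. tset p \<in> E}"
  have P: "tset ` P = {e \<in> E. 5 \<in> e}"
  proof
    show "tset ` P \<subseteq> {e \<in> E. 5 \<in> e}" using tset_link by (auto simp: P_def)
    show "{e \<in> E. 5 \<in> e} \<subseteq> tset ` P"
    proof
      fix e assume e: "e \<in> {e \<in> E. 5 \<in> e}"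
      then have "e \<in> tset ` set link" using E unfolding tset_link by auto
      with e show "e \<in> tset ` P" by (auto simp: P_def)
    qed
  qed
  have "inj_on tset P" by (rule inj_on_subset[OF inj]) (auto simp: P_def)
  then have "card P = 5" using assms(3) P by (metis card_image)
  have "P \<subseteq> set (bad F)"
  proof
    fix p assume p: "p \<in> P"
    have "\<not> K4_covered quads (p # F)"
    proof
      assume "K4_covered quads (p # F)"
      moreover have "distinct (p # F)" using p F dist by (auto simp: P_def)
      moreover have "inj_on tset (set (p # F))"
        by (rule inj_on_subset[OF inj]) (use p F in \<open>auto simp: P_def\<close>)
      ultimately have "is_berge (K_vert 4) (K_edges 4) ({0..<6}, tset ` set (p # F))"
        by (rule is_berge_if_covered)
      then have "is_berge (K_vert 4) (K_edges 4) ({0..<6}, E)"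
        by (rule is_berge_mono) (use p F(4) in \<open>auto simp: P_def\<close>)
      with not show False ..
    qed
    with p show "p \<in> set (bad F)" by (auto simp: bad_def P_def)
  qed
  have dB: "distinct (bad F)" "set (bad F) \<subseteq> set link" using dist by (auto simp: bad_def)
  have "few (bad F) F" using five_triples F(1) by (auto simp: list_all_iff few_bad_def)
  moreover have "5 \<le> length (bad F)"
    using card_mono[OF _ \<open>P \<subseteq> set (bad F)\<close>] \<open>card P = 5\<close> dB(1) by (simp add: distinct_card)
  ultimately have "length (bad F) = 5" and six: "missed_by_six (bad F @ F)"
    by (auto simp: few_def split: if_splits)
  \<comment> \<open>A five-element subset of a set with five elements is the whole set.\<close>
  then have "set (bad F) = P"
    using \<open>P \<subseteq> set (bad F)\<close> \<open>card P = 5\<close> dB(1) by (metis card_subset_eq distinct_card finite_set)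
  obtain w where "w \<in> set [0, 1, 2, 3, 4]" and w6: "6 \<le> length (filter (misses w) (bad F @ F))"
    using six unfolding missed_by_six_def list_ex_iff by blast
  then have w: "w < 6" by auto
  let ?L = "filter (misses w) (bad F @ F)"
  have "distinct ?L" using dB F dist by auto
  moreover have "inj_on tset (set ?L)"
    by (rule inj_on_subset[OF inj]) (use dB F in auto)
  ultimately have "6 \<le> card (tset ` set ?L)"
    using w6 by (metis card_image distinct_card)
  also have "\<dots> \<le> card {e \<in> E. w \<notin> e}"
  proof (rule card_mono)
    show "finite {e \<in> E. w \<notin> e}" using E finite_K3_edges finite_subset by fastforce
    show "tset ` set ?L \<subseteq> {e \<in> E. w \<notin> e}"
      using \<open>set (bad F) = P\<close> F(4) by (auto simp: misses_iff P_def)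
  qed
  finally show False using is_berge_if_six_avoid[OF E w] not by blast
qed

text \<open>Count pairs of a vertex and an edge missing it. Each edge misses three of the six
  vertices, and without a Berge copy each vertex is missed by at most five edges, so three times the
  number of edges is at most 30.\<close>

lemma is_berge_if_ten:
  assumes E: "E \<subseteq> K3_edges 6" and "10 \<le> card E"
  shows "is_berge (K_vert 4) (K_edges 4) ({0..<6}, E)"
proof (rule ccontr)
  assume not: "\<not> ?thesis"
  have fin: "finite E" using E finite_K3_edges finite_subset by blast
  have le: "card {e \<in> E. v \<notin> e} \<le> 5" if "v < 6" for v
    using is_berge_if_six_avoid[OF E that] not by fastforce
  have "(\<Sum>v\<in>{0..<6}. card {e \<in> E. v \<notin> e}) = (\<Sum>e\<in>E. card {v \<in> {0..<6}. v \<notin> e})"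
    using sum.swap_restrict[of "{0..<6::nat}" E "\<lambda>_ _. 1::nat" "\<lambda>v e. v \<notin> e"] fin by simp
  also have "\<dots> = (\<Sum>e\<in>E. 3)"
  proof (rule sum.cong)
    fix e assume "e \<in> E"
    then have "e \<subseteq> {0..<6}" "card e = 3" using E by (auto simp: K3_edges_def)
    moreover have "{v \<in> {0..<6}. v \<notin> e} = {0..<6} - e" by auto
    ultimately show "card {v \<in> {0..<6}. v \<notin> e} = 3"
      by (simp add: card_Diff_subset finite_subset)
  qed simp
  finally have sum: "(\<Sum>v\<in>{0..<6}. card {e \<in> E. v \<notin> e}) = 3 * card E" by simp
  \<comment> \<open>Vertex 5 is singled out: the other five contribute at most 25 to a sum of at
    least 30, so 5 is missed by exactly five edges and there are exactly ten edges.\<close>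
  have "{0..<6::nat} = insert 5 {0..<5}" by auto
  then have "3 * card E = card {e \<in> E. 5 \<notin> e} + (\<Sum>v\<in>{0..<5}. card {e \<in> E. v \<notin> e})"
    using sum by simp
  moreover have "(\<Sum>v\<in>{0..<5}. card {e \<in> E. v \<notin> e}) \<le> 5 * 5"
    using sum_bounded_above[of "{0..<5::nat}" "\<lambda>v. card {e \<in> E. v \<notin> e}" 5] le by simp
  ultimately have "card {e \<in> E. 5 \<notin> e} = 5" "card E = 10"
    using le[of 5] assms(2) by auto
  moreover have "card E = card {e \<in> E. 5 \<notin> e} + card {e \<in> E. 5 \<in> e}"
    using fin by (subst card_Un_disjoint[symmetric]) (auto intro: arg_cong[where f = card])
  ultimately show False using is_berge_if_five_five[OF E] not by simp
qed

section \<open>The upper and lower bounds\<close>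

lemma arrows3_6: "arrows3 6 (Berge (K_vert 4) (K_edges 4)) 2"
  unfolding arrows3_def
proof (intro allI impI)
  fix c :: "nat set \<Rightarrow> nat" assume c: "\<forall>e\<in>K3_edges 6. c e < 2"
  let ?E = "\<lambda>i. {e \<in> K3_edges 6. c e = i}"
  \<comment> \<open>Pigeonhole: two colour classes share 20 edges, so one has at least ten.\<close>
  have "K3_edges 6 = ?E 0 \<union> ?E 1" using c by (auto simp: less_2_cases_iff)
  then have "card (K3_edges 6) \<le> card (?E 0) + card (?E 1)"
    by (metis (no_types, lifting) card_Un_le)
  moreover have "card (K3_edges 6) = 20" by (simp add: card_K3_edges numeral_eq_Suc)
  ultimately have "10 \<le> card (?E 0) \<or> 10 \<le> card (?E 1)" by linarith
  then obtain i where i: "i < 2" "10 \<le> card (?E i)" by (auto intro: that[of 0] that[of 1])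
  then have "is_berge (K_vert 4) (K_edges 4) ({0..<6}, ?E i)"
    by (intro is_berge_if_ten) auto
  with i(1) show "\<exists>i<2. \<exists>V E. V \<subseteq> {0..<6} \<and> E \<subseteq> ?E i \<and> (\<forall>e\<in>E. e \<subseteq> V)
      \<and> (V, E) \<in> Berge (K_vert 4) (K_edges 4)"
    by (intro exI[of _ i] conjI exI[of _ "{0..<6}"] exI[of _ "?E i"])
      (auto simp: Berge_def K3_edges_def)
qed

lemma not_arrows3_less_6:
  assumes "n < 6"
  shows "\<not> arrows3 n (Berge (K_vert 4) (K_edges 4)) 2"
proof
  assume *: "arrows3 n (Berge (K_vert 4) (K_edges 4)) 2"
  have card5: "card (K3_edges 5) = 10" by (simp add: card_K3_edges numeral_eq_Suc)
  \<comment> \<open>Any half of the ten triples on five points will do as colour class 0. The same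
    colouring, restricted, handles every smaller \<open>n\<close> too.\<close>
  then obtain A where A: "A \<subseteq> K3_edges 5" "card A = 5"
    using obtain_subset_with_card_n[of 5 "K3_edges 5"] by auto
  have finA: "finite A" using A finite_K3_edges finite_subset by blast
  have sub: "K3_edges n \<subseteq> K3_edges 5" using assms by (auto simp: K3_edges_def)
  define c where "c = (\<lambda>e. if e \<in> A then 0 else 1 :: nat)"
  have "\<forall>e\<in>K3_edges n. c e < 2" by (simp add: c_def)
  then obtain i V E where i: "i < 2" and E: "E \<subseteq> {e \<in> K3_edges n. c e = i}"
    and VE: "(V, E) \<in> Berge (K_vert 4) (K_edges 4)"
    using *[unfolded arrows3_def, THEN spec, of c] by blast
  \<comment> \<open>A monochromatic \<open>E\<close> lies in one of the two halves, so it has at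
    most five edges, whereas a Berge copy needs a distinct hyperedge for each of the six edges of
    the core graph.\<close>
  have "E \<subseteq> A \<or> E \<subseteq> K3_edges 5 - A" using E sub by (auto simp: c_def split: if_splits)
  moreover have "card (K3_edges 5 - A) = 5"
    using A card5 finA by (simp add: card_Diff_subset)
  ultimately have "card E \<le> 5"
    using A(2) finA finite_K3_edges[of 5] by (auto dest: card_mono[rotated])
  moreover have "finite E" using E sub finite_K3_edges[of n] by (auto intro: finite_subset)
  then have "card (K_edges 4) \<le> card E"
    using VE by (intro card_le_if_is_berge) (auto simp: Berge_def)
  moreover have "card (K_edges 4) = 6"
    using n_subsets[of "{0..<4::nat}" 2] by (simp add: K_edges_def numeral_eq_Suc)
  ultimately show False by simp
qed

theorem theorem4:
  shows "R3 (Berge (K_vert 4) (K_edges 4)) 2 = 6"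
  unfolding R3_def
proof (rule Least_equality)
  show "arrows3 6 (Berge (K_vert 4) (K_edges 4)) 2" by (rule arrows3_6)
  show "6 \<le> n" if "arrows3 n (Berge (K_vert 4) (K_edges 4)) 2" for n
    using that not_arrows3_less_6 not_le by blast
qed

end
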